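(* Let $A$ be an associative unital ring, and let $A^*$ be the ring of countably-valued measurable functions $[0,1]\to A$ modulo equality almost everywhere, with its metric $d^*$ (a complete metrized ring). Then the closure of every prime ideal of $A^*$ is all of $A^*$; hence $A^*$ has no closed prime ideals. On the other hand, if $A$ has no nonzero nilpotent elements, then in $A^*$ the topological radical $\sqrt{\{0\}}$ is $\{0\}$.
   Context: Let $\mu$ be Lebesgue measure on $[0,1]$. For a set $X$, $X'$ denotes the set of functions $f:[0,1]\to X$ such that for every $x\in X$ the set $f_x=\{t\in[0,1]\mid f(t)=x\}$ is Lebesgue measurable, and such that the image of $f$ is countable (finite or countably infinite). For $f,g\in X'$ let $d'(f,g)=\mu(\{t\in[0,1]\mid f(t)\ne g(t)\})$, a pseudometric. $X^*$ is the quotient of $X'$ by the equivalence relation $d'(f,g)=0$, and $d^*$ is the metric on $X^*$ induced by $d'$. When $X=A$ is a ring, $A'$ is closed under the pointwise ring operations, and these induce well-defined ring operations on $A^*$. Ideals are two-sided. A prime ideal of a ring $R$ is a proper ideal $P$ such that for $a,b\in R$, $aRb\subseteq P$ implies $a\in P$ or $b\in P$. For an ideal $I$ of a topological ring $R$, $\sqrt I$ denotes the least closed ideal $J\supseteq I$ such that $J$ contains every $x\in R$ for which $x^n\in J$ for some $n\ge1$. *)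

theory Defs
  imports "HOL-Analysis.Analysis" "HOL-Algebra.Ideal"
begin

section \<open>Countably-valued measurable functions on the unit interval\<close>

text \<open>Functions on the unit interval are represented as extensional functions on the reals,
  i.e. they take the value \<^term>\<open>undefined\<close> outside of \<^term>\<open>{0..1::real}\<close>.\<close>

definition cmfun :: "'a set \<Rightarrow> (real \<Rightarrow> 'a) set" where
  "cmfun X = {f \<in> {0..1} \<rightarrow>\<^sub>E X.
     (\<forall>x\<in>X. {t \<in> {0..1}. f t = x} \<in> sets lebesgue) \<and> countable (f ` {0..1})}"

definition cmdist :: "(real \<Rightarrow> 'a) \<Rightarrow> (real \<Rightarrow> 'a) \<Rightarrow> real" where
  "cmdist f g = measure lebesgue {t \<in> {0..1}. f t \<noteq> g t}"

definition cmrel :: "'a set \<Rightarrow> ((real \<Rightarrow> 'a) \<times> (real \<Rightarrow> 'a)) set" where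
  "cmrel X = {(f, g). f \<in> cmfun X \<and> g \<in> cmfun X \<and> cmdist f g = 0}"

definition cmquot :: "'a set \<Rightarrow> (real \<Rightarrow> 'a) set set" where
  "cmquot X = cmfun X // cmrel X"

text \<open>The induced distance is read off from representatives; see \<open>qdist_class\<close> below for its
  independence of the choice.  Taking representatives by choice makes the function symmetric and
  nonnegative also outside the quotient, as \<^locale>\<open>Metric_space\<close> demands.\<close>

definition qdist :: "(real \<Rightarrow> 'a) set \<Rightarrow> (real \<Rightarrow> 'a) set \<Rightarrow> real" where
  "qdist F G = cmdist (SOME f. f \<in> F) (SOME g. g \<in> G)"

definition pointwise :: "('a \<Rightarrow> 'b \<Rightarrow> 'c) \<Rightarrow> (real \<Rightarrow> 'a) \<Rightarrow> (real \<Rightarrow> 'b) \<Rightarrow> real \<Rightarrow> 'c" where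
  "pointwise h f g = (\<lambda>t\<in>{0..1}. h (f t) (g t))"

definition qop :: "'a set \<Rightarrow> ('a \<Rightarrow> 'a \<Rightarrow> 'a) \<Rightarrow>
    (real \<Rightarrow> 'a) set \<Rightarrow> (real \<Rightarrow> 'a) set \<Rightarrow> (real \<Rightarrow> 'a) set" where
  "qop X h F G = (\<Union>f\<in>F. \<Union>g\<in>G. cmrel X `` {pointwise h f g})"

definition qconst :: "'a set \<Rightarrow> 'a \<Rightarrow> (real \<Rightarrow> 'a) set" where
  "qconst X x = cmrel X `` {\<lambda>t\<in>{0..1}. x}"

definition cmring :: "('a, 'm) ring_scheme \<Rightarrow> (real \<Rightarrow> 'a) set ring" where
  "cmring A = \<lparr>carrier = cmquot (carrier A),
     mult = qop (carrier A) (mult A), one = qconst (carrier A) \<one>\<^bsub>A\<^esub>,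
     zero = qconst (carrier A) \<zero>\<^bsub>A\<^esub>, add = qop (carrier A) (add A)\<rparr>"

abbreviation cmtopology :: "('a, 'm) ring_scheme \<Rightarrow> (real \<Rightarrow> 'a) set topology" where
  "cmtopology A \<equiv> Metric_space.mtopology (carrier (cmring A)) qdist"


section \<open>Noncommutative prime ideals and topological radicals\<close>

text \<open>The locale \<^locale>\<open>primeideal\<close> presupposes a commutative ring.\<close>

definition prime_ideal_nc :: "'a set \<Rightarrow> ('a, 'm) ring_scheme \<Rightarrow> bool" where
  "prime_ideal_nc P R \<longleftrightarrow> ideal P R \<and> P \<noteq> carrier R \<and>
     (\<forall>a\<in>carrier R. \<forall>b\<in>carrier R.
        {a \<otimes>\<^bsub>R\<^esub> r \<otimes>\<^bsub>R\<^esub> b | r. r \<in> carrier R} \<subseteq> P \<longrightarrow> a \<in> P \<or> b \<in> P)"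

definition closed_radical_ideal :: "('a, 'm) ring_scheme \<Rightarrow> 'a topology \<Rightarrow> 'a set \<Rightarrow> bool" where
  "closed_radical_ideal R T J \<longleftrightarrow> ideal J R \<and> closedin T J \<and>
     (\<forall>x\<in>carrier R. (\<exists>n\<ge>1. x [^]\<^bsub>R\<^esub> (n::nat) \<in> J) \<longrightarrow> x \<in> J)"

text \<open>Least with respect to inclusion.\<close>

definition topological_radical :: "('a, 'm) ring_scheme \<Rightarrow> 'a topology \<Rightarrow> 'a set \<Rightarrow> 'a set" where
  "topological_radical R T I = (LEAST J. closed_radical_ideal R T J \<and> I \<subseteq> J)"


section \<open>Well-definedness\<close>

lemma cmfun_measurable2:
  assumes "f \<in> cmfun X" "g \<in> cmfun Y"
  shows "{t \<in> {0..1}. Q (f t) (g t)} \<in> sets lebesgue"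
proof -
  let ?I = "{0..1::real}"
  let ?F = "\<lambda>x. {t \<in> ?I. f t = x}" and ?G = "\<lambda>y. {t \<in> ?I. g t = y}"
  let ?P = "{p \<in> f ` ?I \<times> g ` ?I. Q (fst p) (snd p)}"
  have "{t \<in> ?I. Q (f t) (g t)} = (\<Union>p\<in>?P. ?F (fst p) \<inter> ?G (snd p))"
    by fastforce
  moreover have "countable ?P"
    using assms by (auto simp: cmfun_def intro: countable_subset[of _ "f ` ?I \<times> g ` ?I"])
  moreover have "?F (fst p) \<inter> ?G (snd p) \<in> sets lebesgue" if "p \<in> ?P" for p
  proof -
    have "fst p \<in> X" "snd p \<in> Y"
      using assms that by (auto simp: cmfun_def)
    then show ?thesis
      using assms by (auto simp: cmfun_def)
  qed
  ultimately show ?thesis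
    by (simp only: sets.countable_UN'')
qed

lemma lmeasurable_subset_unit:
  "S \<in> sets lebesgue \<Longrightarrow> S \<subseteq> {0..1::real} \<Longrightarrow> S \<in> lmeasurable"
  by (rule bounded_set_imp_lmeasurable[OF bounded_subset[OF bounded_closed_interval]])

lemma cmdist_lmeasurable:
  assumes "f \<in> cmfun X" "g \<in> cmfun Y"
  shows "{t \<in> {0..1}. f t \<noteq> g t} \<in> lmeasurable"
  by (rule lmeasurable_subset_unit[OF cmfun_measurable2[OF assms] Collect_subset])

lemma cmdist_nonneg: "0 \<le> cmdist f g"
  by (simp add: cmdist_def)

lemma cmdist_commute: "cmdist f g = cmdist g f"
  unfolding cmdist_def by (simp only: neq_commute)

lemma cmdist_triangle:
  assumes "f \<in> cmfun X" "g \<in> cmfun X" "h \<in> cmfun X"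
  shows "cmdist f h \<le> cmdist f g + cmdist g h"
proof -
  let ?D = "\<lambda>u v :: real \<Rightarrow> 'a. {t \<in> {0..1}. u t \<noteq> v t}"
  note D = cmdist_lmeasurable[OF assms(1,2)] cmdist_lmeasurable[OF assms(2,3)]
    cmdist_lmeasurable[OF assms(1,3)]
  have "cmdist f h \<le> measure lebesgue (?D f g \<union> ?D g h)"
    unfolding cmdist_def
    by (rule measure_mono_fmeasurable[OF _ fmeasurableD[OF D(3)] fmeasurable.Un[OF D(1,2)]]) auto
  also have "\<dots> \<le> cmdist f g + cmdist g h"
    unfolding cmdist_def
    by (rule measure_Un_le[OF fmeasurableD[OF D(1)] fmeasurableD[OF D(2)]])
  finally show ?thesis .
qed

lemma cmdist_pointwise:
  assumes "f \<in> cmfun X" "g \<in> cmfun Y" "f' \<in> cmfun X" "g' \<in> cmfun Y"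
  shows "cmdist (pointwise h f g) (pointwise h f' g') \<le> cmdist f f' + cmdist g g'"
proof -
  let ?D = "{t \<in> {0..1}. f t \<noteq> f' t}" and ?E = "{t \<in> {0..1}. g t \<noteq> g' t}"
  have DE: "?D \<in> lmeasurable" "?E \<in> lmeasurable"
    using assms cmdist_lmeasurable by blast+
  have "{t \<in> {0..1}. pointwise h f g t \<noteq> pointwise h f' g' t} \<subseteq> ?D \<union> ?E"
    by (auto simp: pointwise_def)
  then have "cmdist (pointwise h f g) (pointwise h f' g') \<le> measure lebesgue (?D \<union> ?E)"
    if "{t \<in> {0..1}. pointwise h f g t \<noteq> pointwise h f' g' t} \<in> sets lebesgue"
    unfolding cmdist_def by (rule measure_mono_fmeasurable) (use that DE in auto)
  moreover have "measure lebesgue (?D \<union> ?E) \<le> cmdist f f' + cmdist g g'"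
    unfolding cmdist_def by (rule measure_Un_le) (use DE in auto)
  moreover have "{t \<in> {0..1}. pointwise h f g t \<noteq> pointwise h f' g' t} \<in> sets lebesgue"
  proof -
    have 1: "pointwise Pair u v \<in> cmfun (X \<times> Y)" if "u \<in> cmfun X" "v \<in> cmfun Y" for u v
    proof -
      have "countable (pointwise Pair u v ` {0..1})"
        by (rule countable_subset[of _ "u ` {0..1} \<times> v ` {0..1}"])
          (use that in \<open>auto simp: pointwise_def cmfun_def\<close>)
      moreover have "{t \<in> {0..1}. pointwise Pair u v t = p} \<in> sets lebesgue" for p
        using cmfun_measurable2[OF that, of "\<lambda>x y. (x, y) = p"]
        by (simp add: pointwise_def cong: conj_cong)
      ultimately show ?thesis
        using that by (auto simp: cmfun_def pointwise_def)
    qed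
    have "{t \<in> {0..1}. case_prod h (pointwise Pair f g t) \<noteq> case_prod h (pointwise Pair f' g' t)}
        \<in> sets lebesgue"
      by (rule cmfun_measurable2[OF 1 1]) (use assms in auto)
    then show ?thesis
      by (simp add: pointwise_def cong: conj_cong)
  qed
  ultimately show ?thesis
    by linarith
qed

lemma pointwise_in_cmfun:
  assumes "f \<in> cmfun X" "g \<in> cmfun Y" "\<And>x y. x \<in> X \<Longrightarrow> y \<in> Y \<Longrightarrow> h x y \<in> Z"
  shows "pointwise h f g \<in> cmfun Z"
proof -
  have "countable (pointwise h f g ` {0..1})"
    by (rule countable_subset[of _ "case_prod h ` (f ` {0..1} \<times> g ` {0..1})"])
      (use assms in \<open>auto simp: pointwise_def cmfun_def\<close>)
  moreover have "{t \<in> {0..1}. pointwise h f g t = z} \<in> sets lebesgue" for z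
    using cmfun_measurable2[OF assms(1,2), of "\<lambda>x y. h x y = z"]
    by (simp add: pointwise_def cong: conj_cong)
  moreover have "pointwise h f g \<in> {0..1} \<rightarrow>\<^sub>E Z"
    using assms by (auto simp: cmfun_def pointwise_def)
  ultimately show ?thesis
    by (auto simp: cmfun_def)
qed

lemma const_in_cmfun:
  assumes "x \<in> X"
  shows "(\<lambda>t\<in>{0..1}. x) \<in> cmfun X"
proof -
  let ?f = "\<lambda>t\<in>{0..1::real}. x"
  have "{t \<in> {0..1}. ?f t = y} = (if x = y then {0..1} else {})" for y
    by auto
  then have "{t \<in> {0..1}. ?f t = y} \<in> sets lebesgue" for y
    by simp
  moreover have "countable (?f ` {0..1})"
    by (rule countable_subset[of _ "{x}"]) auto
  moreover have "?f \<in> {0..1} \<rightarrow>\<^sub>E X"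
    using assms by simp
  ultimately show ?thesis
    unfolding cmfun_def by blast
qed

lemma equiv_cmrel: "equiv (cmfun X) (cmrel X)"
proof (intro equivI)
  show "refl_on (cmfun X) (cmrel X)"
    by (auto simp: refl_on_def cmrel_def cmdist_def)
  show "sym (cmrel X)"
    by (auto simp: sym_def cmrel_def cmdist_commute)
  show "trans (cmrel X)"
  proof (rule transI)
    fix f g h assume "(f, g) \<in> cmrel X" "(g, h) \<in> cmrel X"
    then show "(f, h) \<in> cmrel X"
      using cmdist_triangle[of f X g h] cmdist_nonneg[of f h] by (auto simp: cmrel_def)
  qed
qed (auto simp: cmrel_def)

lemma class_in_cmquot: "f \<in> cmfun X \<Longrightarrow> cmrel X `` {f} \<in> cmquot X"
  by (simp add: cmquot_def quotientI)

lemma cmquotE: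
  assumes "F \<in> cmquot X"
  obtains f where "f \<in> cmfun X" "F = cmrel X `` {f}"
  using assms by (auto simp: cmquot_def elim: quotientE)

lemma class_eq_iff:
  assumes "f \<in> cmfun X" "g \<in> cmfun X"
  shows "cmrel X `` {f} = cmrel X `` {g} \<longleftrightarrow> cmdist f g = 0"
  using eq_equiv_class_iff[OF equiv_cmrel assms] assms by (auto simp: cmrel_def)

lemma class_some:
  assumes "f \<in> cmfun X"
  shows "(f, SOME u. u \<in> cmrel X `` {f}) \<in> cmrel X"
  using someI_ex[of "\<lambda>u. u \<in> cmrel X `` {f}"] equiv_class_self[OF equiv_cmrel assms] by blast

lemma qdist_class:
  assumes "f \<in> cmfun X" "g \<in> cmfun X"
  shows "qdist (cmrel X `` {f}) (cmrel X `` {g}) = cmdist f g"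
proof -
  define u where "u = (SOME u. u \<in> cmrel X `` {f})"
  define v where "v = (SOME u. u \<in> cmrel X `` {g})"
  have "u \<in> cmfun X" "cmdist f u = 0" "v \<in> cmfun X" "cmdist g v = 0"
    using class_some[OF assms(1)] class_some[OF assms(2)] by (auto simp: cmrel_def u_def v_def)
  then have "cmdist u v = cmdist f g"
    using assms cmdist_triangle[of u X f v] cmdist_triangle[of f X g v]
      cmdist_triangle[of f X u g] cmdist_triangle[of u X v g]
      cmdist_commute[of u f] cmdist_commute[of v g] by linarith
  then show ?thesis
    by (simp add: qdist_def u_def v_def)
qed

lemma Metric_space_cmquot: "Metric_space (cmquot X) qdist"
proof
  fix F G H :: "(real \<Rightarrow> 'a) set"
  show "0 \<le> qdist F G" "qdist F G = qdist G F"
    by (simp_all add: qdist_def cmdist_nonneg cmdist_commute)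
  show "qdist F G = 0 \<longleftrightarrow> F = G" if FG: "F \<in> cmquot X" "G \<in> cmquot X"
  proof -
    obtain f where f: "f \<in> cmfun X" "F = cmrel X `` {f}"
      using FG(1) by (rule cmquotE)
    obtain g where g: "g \<in> cmfun X" "G = cmrel X `` {g}"
      using FG(2) by (rule cmquotE)
    from f g show ?thesis
      by (simp only: qdist_class class_eq_iff)
  qed
  show "qdist F H \<le> qdist F G + qdist G H" if FGH: "F \<in> cmquot X" "G \<in> cmquot X" "H \<in> cmquot X"
  proof -
    obtain f where f: "f \<in> cmfun X" "F = cmrel X `` {f}"
      using FGH(1) by (rule cmquotE)
    obtain g where g: "g \<in> cmfun X" "G = cmrel X `` {g}"
      using FGH(2) by (rule cmquotE)
    obtain h where h: "h \<in> cmfun X" "H = cmrel X `` {h}"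
      using FGH(3) by (rule cmquotE)
    from f g h show ?thesis
      by (simp only: qdist_class cmdist_triangle)
  qed
qed

lemma qop_class:
  assumes "f \<in> cmfun X" "g \<in> cmfun X" and h: "\<And>x y. x \<in> X \<Longrightarrow> y \<in> X \<Longrightarrow> h x y \<in> X"
  shows "qop X h (cmrel X `` {f}) (cmrel X `` {g}) = cmrel X `` {pointwise h f g}"
  unfolding qop_def
proof (rule UN_equiv_class2[OF equiv_cmrel equiv_cmrel _ assms(1,2)], rule congruent2I')
  fix u u' v v' assume *: "(u, u') \<in> cmrel X" "(v, v') \<in> cmrel X"
  then have "cmdist (pointwise h u v) (pointwise h u' v') = 0"
    using cmdist_pointwise[of u X v X u' v' h] cmdist_nonneg[of "pointwise h u v" "pointwise h u' v'"]
    by (auto simp: cmrel_def)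
  then show "cmrel X `` {pointwise h u v} = cmrel X `` {pointwise h u' v'}"
    using * by (subst class_eq_iff) (auto simp: cmrel_def intro!: pointwise_in_cmfun h)
qed

lemma qdist_qop:
  assumes "F \<in> cmquot X" "G \<in> cmquot X" "F' \<in> cmquot X" "G' \<in> cmquot X"
    and h: "\<And>x y. x \<in> X \<Longrightarrow> y \<in> X \<Longrightarrow> h x y \<in> X"
  shows "qdist (qop X h F G) (qop X h F' G') \<le> qdist F F' + qdist G G'"
proof -
  obtain f where f: "f \<in> cmfun X" "F = cmrel X `` {f}"
    using assms(1) by (rule cmquotE)
  obtain g where g: "g \<in> cmfun X" "G = cmrel X `` {g}"
    using assms(2) by (rule cmquotE)
  obtain f' where f': "f' \<in> cmfun X" "F' = cmrel X `` {f'}"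
    using assms(3) by (rule cmquotE)
  obtain g' where g': "g' \<in> cmfun X" "G' = cmrel X `` {g'}"
    using assms(4) by (rule cmquotE)
  from f g f' g' show ?thesis
    by (simp add: qop_class qdist_class pointwise_in_cmfun cmdist_pointwise h)
qed

lemma cmfun_in: "f \<in> cmfun X \<Longrightarrow> t \<in> {0..1} \<Longrightarrow> f t \<in> X"
  by (auto simp: cmfun_def)

lemma cmfun_eqI:
  "f \<in> cmfun X \<Longrightarrow> g \<in> cmfun X \<Longrightarrow> (\<And>t. t \<in> {0..1} \<Longrightarrow> f t = g t) \<Longrightarrow> f = g"
  by (rule PiE_ext[of f "{0..1}" "\<lambda>_. X" g]) (simp_all add: cmfun_def)

theorem ring_cmring:
  assumes "ring A"
  shows "ring (cmring A)"
proof -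
  interpret ring A by fact
  let ?X = "carrier A"
  let ?c = "\<lambda>f. cmrel ?X `` {f}"
  note closed = pointwise_in_cmfun[of _ ?X _ ?X "add A" ?X, OF _ _ add.m_closed]
    pointwise_in_cmfun[of _ ?X _ ?X "mult A" ?X, OF _ _ m_closed]
    const_in_cmfun[of "\<one>\<^bsub>A\<^esub>" ?X, OF one_closed] const_in_cmfun[of "\<zero>\<^bsub>A\<^esub>" ?X, OF zero_closed]
  have ops: "carrier (cmring A) = cmquot ?X"
    "\<one>\<^bsub>cmring A\<^esub> = ?c (\<lambda>t\<in>{0..1}. \<one>\<^bsub>A\<^esub>)" "\<zero>\<^bsub>cmring A\<^esub> = ?c (\<lambda>t\<in>{0..1}. \<zero>\<^bsub>A\<^esub>)"
    "\<And>f g. f \<in> cmfun ?X \<Longrightarrow> g \<in> cmfun ?X \<Longrightarrow>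
      ?c f \<oplus>\<^bsub>cmring A\<^esub> ?c g = ?c (pointwise (add A) f g)"
    "\<And>f g. f \<in> cmfun ?X \<Longrightarrow> g \<in> cmfun ?X \<Longrightarrow>
      ?c f \<otimes>\<^bsub>cmring A\<^esub> ?c g = ?c (pointwise (mult A) f g)"
    by (simp_all add: cmring_def qconst_def qop_class)
  let ?z = "\<lambda>t\<in>{0..1}. \<zero>\<^bsub>A\<^esub>" and ?o = "\<lambda>t\<in>{0..1}. \<one>\<^bsub>A\<^esub>"
  have laws:
    "pointwise (add A) (pointwise (add A) f g) h = pointwise (add A) f (pointwise (add A) g h)"
    "pointwise (mult A) (pointwise (mult A) f g) h = pointwise (mult A) f (pointwise (mult A) g h)"
    "pointwise (mult A) (pointwise (add A) f g) h =
       pointwise (add A) (pointwise (mult A) f h) (pointwise (mult A) g h)"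
    "pointwise (mult A) h (pointwise (add A) f g) =
       pointwise (add A) (pointwise (mult A) h f) (pointwise (mult A) h g)"
    if "f \<in> cmfun ?X" "g \<in> cmfun ?X" "h \<in> cmfun ?X" for f g h
    unfolding pointwise_def restrict_def
    by (rule ext; use that in \<open>simp add: cmfun_in a_assoc m_assoc l_distr r_distr\<close>)+
  have comm: "pointwise (add A) f g = pointwise (add A) g f"
    if "f \<in> cmfun ?X" "g \<in> cmfun ?X" for f g
    unfolding pointwise_def restrict_def
    by (rule ext; use that in \<open>simp add: cmfun_in a_comm\<close>)
  have units: "pointwise (add A) ?z f = f" "pointwise (mult A) ?o f = f" "pointwise (mult A) f ?o = f"
    if "f \<in> cmfun ?X" for f
  proof -
    show "pointwise (add A) ?z f = f"
      using that by (intro cmfun_eqI[of _ ?X] closed) (auto simp: pointwise_def dest: cmfun_in)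
    show "pointwise (mult A) ?o f = f"
      using that by (intro cmfun_eqI[of _ ?X] closed) (auto simp: pointwise_def dest: cmfun_in)
    show "pointwise (mult A) f ?o = f"
      using that by (intro cmfun_eqI[of _ ?X] closed) (auto simp: pointwise_def dest: cmfun_in)
  qed
  show ?thesis
  proof (intro ringI abelian_groupI monoidI)
    show "\<exists>G\<in>carrier (cmring A). G \<oplus>\<^bsub>cmring A\<^esub> F = \<zero>\<^bsub>cmring A\<^esub>" if "F \<in> carrier (cmring A)" for F
    proof -
      obtain f where f: "f \<in> cmfun ?X" "F = ?c f"
        using \<open>F \<in> carrier (cmring A)\<close> by (auto simp: ops elim: cmquotE)
      let ?g = "pointwise (\<lambda>x y. \<ominus>\<^bsub>A\<^esub> x) f f"
      have g: "?g \<in> cmfun ?X"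
        using f by (intro pointwise_in_cmfun) auto
      have "pointwise (add A) ?g f = ?z"
        unfolding pointwise_def restrict_def
        by (rule ext) (use f in \<open>simp add: cmfun_in l_neg\<close>)
      with g show ?thesis
        using f by (intro bexI[of _ "?c ?g"]) (simp_all add: ops class_in_cmquot)
    qed
  next
    fix F G assume "F \<in> carrier (cmring A)" "G \<in> carrier (cmring A)"
    then show "F \<oplus>\<^bsub>cmring A\<^esub> G = G \<oplus>\<^bsub>cmring A\<^esub> F"
      unfolding ops(1) by (elim cmquotE) (simp add: ops comm)
  qed (unfold ops(1), ((elim cmquotE)?; simp add: ops closed class_in_cmquot laws units)+)
qed

text \<open>Addition and multiplication are jointly continuous, by the following estimates.\<close>

theorem qdist_cmring:
  assumes "ring A" "F \<in> carrier (cmring A)" "G \<in> carrier (cmring A)"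
    "F' \<in> carrier (cmring A)" "G' \<in> carrier (cmring A)"
  shows "qdist (F \<oplus>\<^bsub>cmring A\<^esub> G) (F' \<oplus>\<^bsub>cmring A\<^esub> G') \<le> qdist F F' + qdist G G'"
    and "qdist (F \<otimes>\<^bsub>cmring A\<^esub> G) (F' \<otimes>\<^bsub>cmring A\<^esub> G') \<le> qdist F F' + qdist G G'"
proof -
  interpret ring A by fact
  show "qdist (F \<oplus>\<^bsub>cmring A\<^esub> G) (F' \<oplus>\<^bsub>cmring A\<^esub> G') \<le> qdist F F' + qdist G G'"
    "qdist (F \<otimes>\<^bsub>cmring A\<^esub> G) (F' \<otimes>\<^bsub>cmring A\<^esub> G') \<le> qdist F F' + qdist G G'"
    using assms(2-5) by (simp_all add: cmring_def qdist_qop)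
qed

theorem mcomplete_cmquot: "Metric_space.mcomplete (cmquot X) qdist"
proof -
  interpret Metric_space "cmquot X" qdist
    by (rule Metric_space_cmquot)
  show ?thesis
    unfolding mcomplete_def
  proof (intro allI impI)
    fix \<sigma> assume \<sigma>: "MCauchy \<sigma>"
    have "\<exists>N. \<forall>i j. N \<le> i \<longrightarrow> N \<le> j \<longrightarrow> qdist (\<sigma> i) (\<sigma> j) < (1/2)^n" for n :: nat
      using \<sigma> by (auto simp: MCauchy_def)
    then have "\<exists>N. \<forall>n i j. N n \<le> i \<longrightarrow> N n \<le> j \<longrightarrow> qdist (\<sigma> i) (\<sigma> j) < (1/2)^n"
      by (intro choice allI)
    then obtain N where N: "\<And>n i j. N n \<le> i \<Longrightarrow> N n \<le> j \<Longrightarrow> qdist (\<sigma> i) (\<sigma> j) < (1/2)^n"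
      by blast
    define r where "r = rec_nat (N 0) (\<lambda>n k. max (Suc k) (N (Suc n)))"
    have r_Suc: "r (Suc n) = max (Suc (r n)) (N (Suc n))" for n
      by (simp add: r_def)
    have r: "strict_mono r"
      unfolding strict_mono_Suc_iff by (simp add: r_Suc less_max_iff_disj)
    have Nr: "N n \<le> r n" for n
      by (cases n) (simp_all only: r_Suc, simp_all add: r_def)
    have Nr': "N n \<le> r (Suc n)" for n
      using Nr[of n] by (simp add: r_Suc)
    have "\<exists>f. f \<in> cmfun X \<and> \<sigma> (r n) = cmrel X `` {f}" for n
    proof -
      have "\<sigma> (r n) \<in> cmquot X"
        using \<sigma> by (auto simp: MCauchy_def)
      then show ?thesis
        by (rule cmquotE) blast
    qed
    then have "\<exists>f. \<forall>n. f n \<in> cmfun X \<and> \<sigma> (r n) = cmrel X `` {f n}"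
      by (intro choice allI)
    then obtain f where f: "\<And>n. f n \<in> cmfun X" "\<And>n. \<sigma> (r n) = cmrel X `` {f n}"
      by blast
    define D where "D n = {t \<in> {0..1}. f n t \<noteq> f (Suc n) t}" for n
    have D: "D n \<in> lmeasurable" "measure lebesgue (D n) \<le> (1/2)^n" for n
    proof -
      show "D n \<in> lmeasurable"
        unfolding D_def by (rule cmdist_lmeasurable[OF f(1) f(1)])
      have "measure lebesgue (D n) = qdist (\<sigma> (r n)) (\<sigma> (r (Suc n)))"
        unfolding f(2) qdist_class[OF f(1) f(1)] by (simp add: D_def cmdist_def)
      then show "measure lebesgue (D n) \<le> (1/2)^n"
        using N[OF Nr Nr', of n] by simp
    qed
    define c where "c x = (\<lambda>t. \<exists>n. \<forall>m\<ge>n. f m t = x)" for x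
    define g where "g = (\<lambda>t\<in>{0..1}. if \<exists>x. c x t then (SOME x. c x t) else f 0 t)"
    have g_eq: "g t = x" if "c x t" "t \<in> {0..1}" for x t
    proof -
      have uniq: "y = x" if "c y t" for y
      proof -
        obtain n k where "\<forall>m\<ge>n. f m t = x" "\<forall>m\<ge>k. f m t = y"
          using \<open>c x t\<close> \<open>c y t\<close> by (auto simp: c_def)
        then show ?thesis
          by (metis max.cobounded1 max.cobounded2)
      qed
      have "\<exists>y. c y t"
        using that(1) by blast
      then have "g t = (SOME y. c y t)"
        using that(2) by (simp add: g_def)
      also have "\<dots> = x"
        by (rule some_equality) (fact that(1), erule uniq)
      finally show ?thesis .
    qed
    have g_eq0: "g t = f 0 t" if "\<nexists>x. c x t" "t \<in> {0..1}" for t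
      using that by (simp add: g_def)
    have c_meas: "{t \<in> {0..1}. c x t} \<in> sets lebesgue" for x
    proof -
      have "{t \<in> {0..1}. c x t} = (\<Union>n. \<Inter>m\<in>{n..}. {t \<in> {0..1}. f m t = x})"
        by (auto simp: c_def)
      moreover have "{t \<in> {0..1}. f m t = x} \<in> sets lebesgue" for m
        using cmfun_measurable2[OF f(1) f(1), of "\<lambda>u v. u = x" m] by simp
      ultimately show ?thesis
        by (simp only:) (intro sets.countable_UN sets.countable_INT'' image_subsetI; simp)
    qed
    define V where "V = (\<Union>n. f n ` {0..1})"
    have V: "countable V"
      using f(1) by (auto simp: V_def cmfun_def)
    have cV: "x \<in> V" if xt: "c x t" "t \<in> {0..1}" for x t
    proof -
      obtain n where "\<forall>m\<ge>n. f m t = x"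
        using xt(1) unfolding c_def by blast
      then have "x = f n t"
        by simp
      then show ?thesis
        unfolding V_def using xt(2) by blast
    qed
    have "V \<subseteq> X"
      using f(1) by (auto simp: V_def cmfun_def)
    have gV: "g t \<in> V" if "t \<in> {0..1}" for t
    proof (cases "\<exists>x. c x t")
      case True
      then show ?thesis
        using that g_eq cV by metis
    next
      case False
      then have "g t = f 0 t"
        using that by (rule g_eq0)
      moreover have "f 0 t \<in> V"
        unfolding V_def using that by blast
      ultimately show ?thesis
        by simp
    qed
    have "g \<in> cmfun X"
    proof -
      have "{t \<in> {0..1}. g t = x} \<in> sets lebesgue" for x
      proof -
        let ?B = "\<Union>y\<in>V. {t \<in> {0..1}. c y t}"
        have "{t \<in> {0..1}. g t = x} = {t \<in> {0..1}. c x t} \<union> ({t \<in> {0..1}. f 0 t = x} - ?B)"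
        proof (rule Set.set_eqI, rule iffI)
          fix t assume t: "t \<in> {t \<in> {0..1}. g t = x}"
          show "t \<in> {t \<in> {0..1}. c x t} \<union> ({t \<in> {0..1}. f 0 t = x} - ?B)"
          proof (cases "\<exists>y. c y t")
            case True
            then show ?thesis
              using t g_eq by blast
          next
            case False
            then show ?thesis
              using t g_eq0 by auto
          qed
        next
          fix t assume t: "t \<in> {t \<in> {0..1}. c x t} \<union> ({t \<in> {0..1}. f 0 t = x} - ?B)"
          then show "t \<in> {t \<in> {0..1}. g t = x}"
          proof
            assume "t \<in> {t \<in> {0..1}. c x t}"
            then show ?thesis
              using g_eq by blast
          next
            assume *: "t \<in> {t \<in> {0..1}. f 0 t = x} - ?B"
            then have "\<not> (\<exists>y. c y t)"
              using cV by blast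
            then show ?thesis
              using * g_eq0 by auto
          qed
        qed
        moreover have "?B \<in> sets lebesgue"
          using V c_meas by (intro sets.countable_UN'') auto
        moreover have "{t \<in> {0..1}. f 0 t = x} \<in> sets lebesgue"
          using cmfun_measurable2[OF f(1) f(1), of "\<lambda>u v. u = x" 0] by simp
        ultimately show ?thesis
          using c_meas by auto
      qed
      moreover have "countable (g ` {0..1})"
        by (rule countable_subset[OF _ V]) (use gV in blast)
      moreover have "g \<in> {0..1} \<rightarrow>\<^sub>E X"
      proof (rule PiE_I)
        show "g t \<in> X" if "t \<in> {0..1}" for t
          using gV[OF that] \<open>V \<subseteq> X\<close> by blast
        show "g t = undefined" if "t \<notin> {0..1}" for t
          unfolding g_def restrict_def using that by (simp only: if_False)
      qed
      ultimately show ?thesis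
        unfolding cmfun_def by blast
    qed
    have bound: "cmdist (f n) g \<le> 2 * (1/2)^n" for n
    proof -
      have sub: "{t \<in> {0..1}. f n t \<noteq> g t} \<subseteq> (\<Union>i. D (n + i))"
      proof (rule ccontr)
        assume "\<not> ?thesis"
        then obtain t where t: "t \<in> {0..1}" "f n t \<noteq> g t" "\<And>i. t \<notin> D (n + i)"
          by blast
        have "f (n + i) t = f n t" for i
          using t(1,3) by (induction i) (simp_all add: D_def)
        then have "c (f n t) t"
          unfolding c_def by (metis le_add_diff_inverse)
        from g_eq[OF this t(1)] t(2) show False
          by simp
      qed
      have sum_le: "(\<Sum>i\<le>k. measure lebesgue (D (n + i))) \<le> 2 * (1/2)^n" for k
      proof -
        have "(\<Sum>i\<le>k. measure lebesgue (D (n + i))) \<le> (\<Sum>i\<le>k. (1/2)^(n + i))"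
          by (intro sum_mono D)
        also have "\<dots> = (1/2)^n * (\<Sum>i\<le>k. (1/2)^i)"
          by (simp add: power_add sum_distrib_left)
        also have "(\<Sum>i\<le>k. (1/2::real)^i) = 2 - (1/2)^k"
          by (induction k) simp_all
        also have "(1/2)^n * (2 - (1/2)^k) \<le> (1/2)^n * (2::real)"
          by (intro mult_left_mono) simp_all
        finally show ?thesis
          by (simp only: mult.commute)
      qed
      have le: "measure lebesgue (\<Union>i\<le>k. D (n + i)) \<le> 2 * (1/2)^n" for k
      proof (rule order_trans[OF measure_UNION_le sum_le])
        show "D (n + i) \<in> sets lebesgue" for i
          by (rule fmeasurableD[OF D(1)])
      qed simp
      have U: "(\<Union>i. D (n + i)) \<in> lmeasurable" "measure lebesgue (\<Union>i. D (n + i)) \<le> 2 * (1/2)^n"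
        by (rule fmeasurable_countable_Union measure_countable_Union_le; use D(1) le in blast)+
      have "cmdist (f n) g \<le> measure lebesgue (\<Union>i. D (n + i))"
        unfolding cmdist_def
        by (rule measure_mono_fmeasurable
            [OF sub fmeasurableD[OF cmdist_lmeasurable[OF f(1) \<open>g \<in> cmfun X\<close>]] U(1)])
      also have "\<dots> \<le> 2 * (1/2)^n"
        by (rule U(2))
      finally show ?thesis .
    qed
    have "limitin mtopology (\<sigma> \<circ> r) (cmrel X `` {g}) sequentially"
      unfolding limitin_metric_dist_null
    proof (intro conjI)
      show "(\<lambda>n. qdist ((\<sigma> \<circ> r) n) (cmrel X `` {g})) \<longlonglongrightarrow> 0"
      proof (rule tendsto_sandwich)
        show "(\<lambda>n. 0 :: real) \<longlonglongrightarrow> 0"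
          by simp
        show "(\<lambda>n. 2 * (1/2)^n :: real) \<longlonglongrightarrow> 0"
          by (intro tendsto_mult_right_zero LIMSEQ_power_zero) auto
      qed (simp_all add: f(2) qdist_class[OF f(1) \<open>g \<in> cmfun X\<close>] cmdist_nonneg bound del: power_divide)
    qed (use f \<open>g \<in> cmfun X\<close> in \<open>auto simp: class_in_cmquot\<close>)
    then show "\<exists>x. limitin mtopology \<sigma> x sequentially"
      using MCauchy_convergent_subsequence[OF \<sigma> r] by blast
  qed
qed

lemma topological_radical_least:
  assumes "ring R" "topspace T = carrier R" "I \<subseteq> carrier R"
  shows "closed_radical_ideal R T (topological_radical R T I)" "I \<subseteq> topological_radical R T I"
    "\<And>J. closed_radical_ideal R T J \<Longrightarrow> I \<subseteq> J \<Longrightarrow> topological_radical R T I \<subseteq> J"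
proof -
  interpret ring R by fact
  let ?S = "{J. closed_radical_ideal R T J \<and> I \<subseteq> J}"
  have ne: "carrier R \<in> ?S"
    using assms oneideal closedin_topspace[of T] by (auto simp: closed_radical_ideal_def)
  have "ideal (\<Inter>?S) R"
    using ne by (intro i_Intersect) (auto simp: closed_radical_ideal_def)
  moreover have "closedin T (\<Inter>?S)"
    using ne by (intro closedin_Inter) (auto simp: closed_radical_ideal_def)
  ultimately have "closed_radical_ideal R T (\<Inter>?S)"
    unfolding closed_radical_ideal_def by blast
  then have "topological_radical R T I = \<Inter>?S"
    unfolding topological_radical_def by (intro Least_equality) auto
  then show "closed_radical_ideal R T (topological_radical R T I)" "I \<subseteq> topological_radical R T I"
    "\<And>J. closed_radical_ideal R T J \<Longrightarrow> I \<subseteq> J \<Longrightarrow> topological_radical R T I \<subseteq> J"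
    using \<open>closed_radical_ideal R T (\<Inter>?S)\<close> by auto
qed

end

theory Submission
  imports Defs
begin

text \<open>The indicator \<open>e\<^sub>S\<close> of a measurable set \<open>S\<close> is an idempotent of \<open>A\<^sup>*\<close>, and
  \<open>e\<^sub>S A\<^sup>* e\<^sub>T = 0\<close> for disjoint \<open>S\<close> and \<open>T\<close>. So a prime ideal \<open>P\<close> contains, for every \<open>t\<close>, the
  indicator of \<open>(-\<infinity>, t]\<close> or that of \<open>(t, \<infinity>)\<close>. If \<open>s\<close> is the supremum of the \<open>t\<close> of the
  first kind, then \<open>P\<close> contains the indicators of complements of arbitrarily short intervals
  around \<open>s\<close>. These converge to \<open>1\<close>, hence \<open>P\<close> is dense. For reduced \<open>A\<close>, a
  function vanishes wherever one of its powers does, and \<open>{0}\<close> is closed.\<close>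

text \<open>\<open>S\<close> is any set of reals, not only a subset of the unit interval: half-lines
  can be used as they are, and \<open>UNIV\<close> and \<open>{}\<close> give the unit and the
  zero.\<close>

definition cmind :: "('a, 'm) ring_scheme \<Rightarrow> real set \<Rightarrow> real \<Rightarrow> 'a" where
  "cmind A S = (\<lambda>t\<in>{0..1}. if t \<in> S then \<one>\<^bsub>A\<^esub> else \<zero>\<^bsub>A\<^esub>)"

abbreviation qind :: "('a, 'm) ring_scheme \<Rightarrow> real set \<Rightarrow> (real \<Rightarrow> 'a) set" where
  "qind A S \<equiv> cmrel (carrier A) `` {cmind A S}"

lemma carrier_cmring: "carrier (cmring A) = cmquot (carrier A)"
  by (simp add: cmring_def)

lemma one_cmring: "\<one>\<^bsub>cmring A\<^esub> = qind A UNIV"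
  by (simp add: cmring_def qconst_def cmind_def)

lemma zero_cmring: "\<zero>\<^bsub>cmring A\<^esub> = qind A {}"
  by (simp add: cmring_def qconst_def cmind_def)

context ring
begin

lemma add_cmring_class:
  assumes "f \<in> cmfun (carrier R)" "g \<in> cmfun (carrier R)"
  shows "cmrel (carrier R) `` {f} \<oplus>\<^bsub>cmring R\<^esub> cmrel (carrier R) `` {g} =
    cmrel (carrier R) `` {pointwise (add R) f g}"
  using assms by (simp add: cmring_def qop_class)

lemma mult_cmring_class:
  assumes "f \<in> cmfun (carrier R)" "g \<in> cmfun (carrier R)"
  shows "cmrel (carrier R) `` {f} \<otimes>\<^bsub>cmring R\<^esub> cmrel (carrier R) `` {g} =
    cmrel (carrier R) `` {pointwise (mult R) f g}"
  using assms by (simp add: cmring_def qop_class)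

lemma cmind_in_cmfun:
  assumes "S \<in> sets lebesgue"
  shows "cmind R S \<in> cmfun (carrier R)"
proof -
  have "{t \<in> {0..1}. cmind R S t = x} =
      (if x = \<one> then {0..1} \<inter> S else {}) \<union> (if x = \<zero> then {0..1} - S else {})" for x
    by (auto simp: cmind_def)
  then have "{t \<in> {0..1}. cmind R S t = x} \<in> sets lebesgue" for x
    using assms by (simp only:) (intro sets.Un; auto)
  moreover have "countable (cmind R S ` {0..1})"
    by (rule countable_subset[of _ "{\<zero>, \<one>}"]) (auto simp: cmind_def)
  moreover have "cmind R S \<in> {0..1} \<rightarrow>\<^sub>E carrier R"
    by (auto simp: cmind_def)
  ultimately show ?thesis
    by (simp add: cmfun_def)
qed

lemma qind_closed: "S \<in> sets lebesgue \<Longrightarrow> qind R S \<in> carrier (cmring R)"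
  by (simp add: carrier_cmring class_in_cmquot cmind_in_cmfun)

lemma qind_add:
  assumes "S \<in> sets lebesgue" "T \<in> sets lebesgue" "S \<inter> T = {}"
  shows "qind R S \<oplus>\<^bsub>cmring R\<^esub> qind R T = qind R (S \<union> T)"
proof -
  have "pointwise (add R) (cmind R S) (cmind R T) = cmind R (S \<union> T)"
    by (rule ext) (use assms(3) in \<open>auto simp: pointwise_def cmind_def\<close>)
  then show ?thesis
    using assms by (simp add: add_cmring_class cmind_in_cmfun)
qed

text \<open>At every point one of the outer factors vanishes. The arbitrary middle factor is what
  primeness in a noncommutative ring asks for.\<close>

lemma qind_sandwich:
  assumes "S \<in> sets lebesgue" "T \<in> sets lebesgue" "S \<inter> T = {}" "F \<in> carrier (cmring R)"
  shows "qind R S \<otimes>\<^bsub>cmring R\<^esub> F \<otimes>\<^bsub>cmring R\<^esub> qind R T = \<zero>\<^bsub>cmring R\<^esub>"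
proof -
  obtain f where f: "f \<in> cmfun (carrier R)" "F = cmrel (carrier R) `` {f}"
    using assms(4) by (auto simp: carrier_cmring elim: cmquotE)
  have "pointwise (mult R) (pointwise (mult R) (cmind R S) f) (cmind R T) = cmind R {}"
    by (rule ext) (use assms(3) cmfun_in[OF f(1)] in \<open>auto simp: pointwise_def cmind_def\<close>)
  moreover have "pointwise (mult R) (cmind R S) f \<in> cmfun (carrier R)"
    using assms f by (intro pointwise_in_cmfun[OF cmind_in_cmfun]) auto
  ultimately show ?thesis
    using assms f by (simp add: mult_cmring_class cmind_in_cmfun zero_cmring)
qed

text \<open>Only an inequality, since in the zero ring \<open>\<one>\<close> and
  \<open>\<zero>\<close> coincide and the distance is 0.\<close>

lemma qdist_qind_one:
  assumes "S \<in> sets lebesgue"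
  shows "qdist (qind R S) \<one>\<^bsub>cmring R\<^esub> \<le> measure lebesgue ({0..1} - S)"
proof -
  have "{t \<in> {0..1}. cmind R S t \<noteq> cmind R UNIV t} \<subseteq> {0..1} - S"
    by (auto simp: cmind_def)
  moreover have "{0..1} - S \<in> lmeasurable"
    using assms by (intro lmeasurable_subset_unit) auto
  ultimately have "cmdist (cmind R S) (cmind R UNIV) \<le> measure lebesgue ({0..1} - S)"
    unfolding cmdist_def using assms
    by (intro measure_mono_fmeasurable
        fmeasurableD[OF cmdist_lmeasurable[OF cmind_in_cmfun cmind_in_cmfun]]) simp_all
  then show ?thesis
    using assms by (simp add: one_cmring qdist_class cmind_in_cmfun)
qed

lemma prime_ideal_qind:
  assumes P: "prime_ideal_nc P (cmring R)" and S: "S \<in> sets lebesgue" "T \<in> sets lebesgue"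
    and "S \<inter> T = {}"
  shows "qind R S \<in> P \<or> qind R T \<in> P"
proof -
  interpret P: ideal P "cmring R"
    using P by (simp add: prime_ideal_nc_def)
  have "{qind R S \<otimes>\<^bsub>cmring R\<^esub> F \<otimes>\<^bsub>cmring R\<^esub> qind R T | F. F \<in> carrier (cmring R)} \<subseteq> P"
    using qind_sandwich[OF assms(2-4)] by auto
  then show ?thesis
    using P qind_closed[OF S(1)] qind_closed[OF S(2)] unfolding prime_ideal_nc_def by blast
qed

lemma prime_ideal_near_one:
  assumes P: "prime_ideal_nc P (cmring R)" and "0 < \<epsilon>"
  obtains E where "E \<in> P" "qdist E \<one>\<^bsub>cmring R\<^esub> < \<epsilon>"
proof -
  interpret P: ideal P "cmring R"
    using P by (simp add: prime_ideal_nc_def)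
  define T where "T = {t. qind R {..t} \<in> P}"
  \<comment> \<open>The half-line up to -1 misses the unit interval, so its indicator is zero there.
    This makes \<open>T\<close> nonempty.\<close>
  have "qind R {..-1} = \<zero>\<^bsub>cmring R\<^esub>"
    unfolding zero_cmring
    by (rule arg_cong[of _ _ "\<lambda>f. cmrel (carrier R) `` {f}"]) (auto simp: cmind_def)
  then have T_ne: "-1 \<in> T"
    by (simp add: T_def)
  \<comment> \<open>Beyond 1 the half-line covers the unit interval, and its indicator is the unit,
    which a proper ideal cannot contain.\<close>
  have T_le: "t \<le> 1" if "t \<in> T" for t
  proof (rule ccontr)
    assume "\<not> t \<le> 1"
    then have "qind R {..t} = \<one>\<^bsub>cmring R\<^esub>"
      unfolding one_cmring
      by (intro arg_cong[of _ _ "\<lambda>f. cmrel (carrier R) `` {f}"]) (auto simp: cmind_def)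
    then have "P = carrier (cmring R)"
      using that by (intro P.one_imp_carrier) (simp add: T_def)
    then show False
      using P by (simp add: prime_ideal_nc_def)
  qed
  then have bdd: "bdd_above T"
    by (auto simp: bdd_above_def)
  have "Sup T - \<epsilon> / 3 < Sup T"
    using \<open>0 < \<epsilon>\<close> by simp
  then obtain t where t: "t \<in> T" "Sup T - \<epsilon> / 3 < t"
    using less_cSup_iff[OF _ bdd] T_ne by blast
  \<comment> \<open>\<open>t\<close> lies less than \<epsilon>/3 below the supremum and
    \<open>u\<close> lies \<epsilon>/3 above it, so the gap is less than 2\<epsilon>/3, and
    \<open>u\<close> is outside \<open>T\<close>.\<close>
  define u where "u = Sup T + \<epsilon> / 3"
  have "t \<le> Sup T"
    using t(1) bdd by (rule cSup_upper)
  then have tu: "t < u" "u - t < \<epsilon>"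
    using t(2) \<open>0 < \<epsilon>\<close> by (simp_all add: u_def)
  have "u \<notin> T"
    using cSup_upper[OF _ bdd, of u] \<open>0 < \<epsilon>\<close> by (auto simp: u_def)
  \<comment> \<open>Primeness puts one of two complementary half-lines into \<open>P\<close>, and
    \<open>u \<notin> T\<close> rules out the left one.\<close>
  then have "qind R {u<..} \<in> P"
    using prime_ideal_qind[OF P, of "{..u}" "{u<..}"] by (fastforce simp: T_def)
  then have "qind R {..t} \<oplus>\<^bsub>cmring R\<^esub> qind R {u<..} \<in> P"
    using t(1) by (simp add: T_def)
  then have "qind R ({..t} \<union> {u<..}) \<in> P"
    using tu(1) by (subst (asm) qind_add) auto
  moreover have "qdist (qind R ({..t} \<union> {u<..})) \<one>\<^bsub>cmring R\<^esub> < \<epsilon>"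
  proof -
    \<comment> \<open>What the two half-lines leave out of the unit interval lies between
      \<open>t\<close> and \<open>u\<close>.\<close>
    have "measure lebesgue ({0..1} - ({..t} \<union> {u<..})) \<le> measure lebesgue {t..u}"
      by (intro measure_mono_fmeasurable) auto
    then show ?thesis
      using tu qdist_qind_one[of "{..t} \<union> {u<..}"] by simp
  qed
  ultimately show ?thesis
    by (rule that)
qed

lemma prime_ideal_dense:
  assumes P: "prime_ideal_nc P (cmring R)"
  shows "cmtopology R closure_of P = carrier (cmring R)"
proof -
  interpret Metric_space "carrier (cmring R)" qdist
    by (simp add: carrier_cmring Metric_space_cmquot)
  interpret P: ideal P "cmring R"
    using P by (simp add: prime_ideal_nc_def)
  have "\<exists>G\<in>P. G \<in> mball F \<epsilon>" if F: "F \<in> carrier (cmring R)" and "0 < \<epsilon>" for F \<epsilon>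
  proof -
    obtain E where E: "E \<in> P" "qdist E \<one>\<^bsub>cmring R\<^esub> < \<epsilon>"
      using prime_ideal_near_one[OF P \<open>0 < \<epsilon>\<close>] .
    have E': "E \<in> carrier (cmring R)"
      using E(1) by (rule P.a_Hcarr)
    \<comment> \<open>Multiplication by \<open>F\<close> does not increase distances, so
      \<open>E\<close> close to the unit makes the element \<open>F E\<close> of \<open>P\<close>
      equally close to \<open>F\<close>.\<close>
    have "qdist (F \<otimes>\<^bsub>cmring R\<^esub> \<one>\<^bsub>cmring R\<^esub>) (F \<otimes>\<^bsub>cmring R\<^esub> E) \<le> qdist F F + qdist \<one>\<^bsub>cmring R\<^esub> E"
      using F E' by (intro qdist_cmring ring_axioms) auto
    then have "qdist F (F \<otimes>\<^bsub>cmring R\<^esub> E) < \<epsilon>"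
      using F E(2) commute[of E] by simp
    then show ?thesis
      using F E E' by (intro bexI[of _ "F \<otimes>\<^bsub>cmring R\<^esub> E"]) (auto intro: P.I_l_closed)
  qed
  then show ?thesis
    unfolding metric_closure_of by blast
qed

text \<open>Membership is carried through the induction because the product of two classes can be
  computed on representatives only once these are known to be in \<open>cmfun\<close>.\<close>

lemma nat_pow_cmring_class:
  assumes f: "f \<in> cmfun (carrier R)"
  shows "(\<lambda>t\<in>{0..1}. f t [^] n) \<in> cmfun (carrier R) \<and>
    (cmrel (carrier R) `` {f}) [^]\<^bsub>cmring R\<^esub> n = cmrel (carrier R) `` {\<lambda>t\<in>{0..1}. f t [^] (n::nat)}"
proof (induction n)
  case 0
  then show ?case
    using const_in_cmfun[OF one_closed]
    by (simp add: cmring_def qconst_def nat_pow_0[abs_def] del: restrict_apply)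
next
  case (Suc n)
  have "pointwise (mult R) (\<lambda>t\<in>{0..1}. f t [^] n) f = (\<lambda>t\<in>{0..1}. f t [^] Suc n)"
    by (auto simp: pointwise_def)
  moreover have "pointwise (mult R) (\<lambda>t\<in>{0..1}. f t [^] n) f \<in> cmfun (carrier R)"
    using Suc f
    by (intro pointwise_in_cmfun[of _ "carrier R" _ "carrier R"]) (simp_all del: restrict_apply)
  ultimately show ?case
    using Suc f mult_cmring_class[of "\<lambda>t\<in>{0..1}. f t [^] n" f]
    by (simp del: restrict_apply)
qed

lemma nilpotent_cmring_eq_zero:
  assumes red: "\<And>x n. x \<in> carrier R \<Longrightarrow> 1 \<le> n \<Longrightarrow> x [^] (n::nat) = \<zero> \<Longrightarrow> x = \<zero>"
    and F: "F \<in> carrier (cmring R)" and n: "1 \<le> n"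
    and "F [^]\<^bsub>cmring R\<^esub> (n::nat) = \<zero>\<^bsub>cmring R\<^esub>"
  shows "F = \<zero>\<^bsub>cmring R\<^esub>"
proof -
  obtain f where f: "f \<in> cmfun (carrier R)" "F = cmrel (carrier R) `` {f}"
    using F by (auto simp: carrier_cmring elim: cmquotE)
  have z: "cmind R {} \<in> cmfun (carrier R)"
    by (rule cmind_in_cmfun) simp
  \<comment> \<open>The two functions have the same zeros at every point, with no null set to
    discard, hence the same distance from zero. The direction from right to left rests on
    \<open>1 \<le> n\<close>.\<close>
  have "f t [^] n = \<zero> \<longleftrightarrow> f t = \<zero>" if "t \<in> {0..1}" for t
    using red[OF cmfun_in[OF f(1) that] n] n by (auto simp: nat_pow_zero)
  then have "cmdist f (cmind R {}) = cmdist (\<lambda>t\<in>{0..1}. f t [^] n) (cmind R {})"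
    by (simp add: cmdist_def cmind_def cong: conj_cong)
  also have "\<dots> = 0"
    using assms(4) nat_pow_cmring_class[OF f(1), of n] z f(2)
    by (simp add: zero_cmring class_eq_iff)
  finally show ?thesis
    using f z by (simp add: zero_cmring class_eq_iff)
qed

text \<open>The zero ideal itself qualifies as a closed radical ideal: points are closed in a metric
  space, and there are no nonzero nilpotents. Minimality does the rest.\<close>

lemma topological_radical_cmring_zero:
  assumes "\<And>x n. x \<in> carrier R \<Longrightarrow> 1 \<le> n \<Longrightarrow> x [^] (n::nat) = \<zero> \<Longrightarrow> x = \<zero>"
  shows "topological_radical (cmring R) (cmtopology R) {\<zero>\<^bsub>cmring R\<^esub>} = {\<zero>\<^bsub>cmring R\<^esub>}"
proof -
  interpret C: ring "cmring R"
    by (rule ring_cmring) (rule ring_axioms)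
  interpret Metric_space "carrier (cmring R)" qdist
    by (simp add: carrier_cmring Metric_space_cmquot)
  have "closedin (cmtopology R) {\<zero>\<^bsub>cmring R\<^esub>}"
    by (rule closedin_Hausdorff_singleton[OF Hausdorff_space_mtopology]) simp
  moreover have "F = \<zero>\<^bsub>cmring R\<^esub>"
    if "F \<in> carrier (cmring R)" "1 \<le> n" "F [^]\<^bsub>cmring R\<^esub> (n::nat) = \<zero>\<^bsub>cmring R\<^esub>" for F n
    by (rule nilpotent_cmring_eq_zero[OF _ that]) (rule assms)
  ultimately have "closed_radical_ideal (cmring R) (cmtopology R) {\<zero>\<^bsub>cmring R\<^esub>}"
    using C.zeroideal unfolding closed_radical_ideal_def singleton_iff by metis
  then show ?thesis
    using topological_radical_least[OF C.ring_axioms topspace_mtopology, of "{\<zero>\<^bsub>cmring R\<^esub>}"]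
    by (intro subset_antisym) auto
qed

end

theorem proposition8:
  fixes A :: "('a, 'm) ring_scheme"
  assumes "ring A"
  shows "(\<forall>P. prime_ideal_nc P (cmring A) \<longrightarrow>
            cmtopology A closure_of P = carrier (cmring A)) \<and>
         (\<nexists>P. prime_ideal_nc P (cmring A) \<and> closedin (cmtopology A) P) \<and>
         ((\<forall>x\<in>carrier A. (\<exists>n\<ge>1. x [^]\<^bsub>A\<^esub> (n::nat) = \<zero>\<^bsub>A\<^esub>) \<longrightarrow> x = \<zero>\<^bsub>A\<^esub>) \<longrightarrow>
            topological_radical (cmring A) (cmtopology A) {\<zero>\<^bsub>cmring A\<^esub>} = {\<zero>\<^bsub>cmring A\<^esub>})"
proof (intro conjI allI impI notI)
  fix P assume "prime_ideal_nc P (cmring A)"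
  then show "cmtopology A closure_of P = carrier (cmring A)"
    by (rule ring.prime_ideal_dense[OF assms])
next
  assume "\<exists>P. prime_ideal_nc P (cmring A) \<and> closedin (cmtopology A) P"
  then obtain P where P: "prime_ideal_nc P (cmring A)" "closedin (cmtopology A) P"
    by blast
  \<comment> \<open>A closed set is its own closure, so density would make \<open>P\<close> the
    whole ring.\<close>
  then have "P = carrier (cmring A)"
    using ring.prime_ideal_dense[OF assms] closure_of_closedin by metis
  with P(1) show False
    by (simp add: prime_ideal_nc_def)
next
  assume "\<forall>x\<in>carrier A. (\<exists>n\<ge>1. x [^]\<^bsub>A\<^esub> (n::nat) = \<zero>\<^bsub>A\<^esub>) \<longrightarrow> x = \<zero>\<^bsub>A\<^esub>"
  then show "topological_radical (cmring A) (cmtopology A) {\<zero>\<^bsub>cmring A\<^esub>} = {\<zero>\<^bsub>cmring A\<^esub>}"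
    by (intro ring.topological_radical_cmring_zero[OF assms]) blast
qed

end
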